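(* There exists a matrix $\mathbf{G}\in\mathbb{R}^{4\times4}$ such that $$\bigl\langle \mathbf{G},\operatorname{sign}(\operatorname{polar}(\mathbf{G}))\bigr\rangle=-\tfrac{42468}{103}<0 .$$ Consequently SignMuon ascends on the linear objective $f(\mathbf{X})=\langle\mathbf{G},\mathbf{X}\rangle=\operatorname{Tr}(\mathbf{G}^\top\mathbf{X})$ on $\mathbb{R}^{4\times 4}$: for every starting point $\mathbf{X}_0$, every sequence of step sizes $\eta_t>0$, every momentum coefficient $\mu\in[0,1)$ and both momentum variants (standard and Nesterov), $f(\mathbf{X}_t)>f(\mathbf{X}_{t-1})$ for every $t\ge1$.
   Context: $\langle\mathbf{A},\mathbf{B}\rangle=\sum_{i,j}A_{ij}B_{ij}$. For a matrix $\mathbf{M}$ of rank $r$ with thin singular value decomposition $\mathbf{M}=\mathbf{U}\boldsymbol{\Sigma}\mathbf{V}^\top$ ($\mathbf{U},\mathbf{V}$ with $r$ orthonormal columns, one per nonzero singular value), $\operatorname{polar}(\mathbf{M}):=\mathbf{U}\mathbf{V}^\top$. The function $\operatorname{sign}(\cdot)$ acts entrywise with values in $\{\pm1\}$; an exact zero is resolved to an arbitrary (random) $\pm1$, and assertions about signs are to hold for every such resolution. SignMuon with exact gradients: $\mathbf{M}_0=\mathbf{0}$ and, for $t\ge1$, $\mathbf{G}_t=\nabla f(\mathbf{X}_{t-1})$, $\mathbf{M}_t=\mu\mathbf{M}_{t-1}+(1-\mu)\mathbf{G}_t$; $\tilde{\mathbf{M}}_t=\mathbf{M}_t$ (standard)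 or $\tilde{\mathbf{M}}_t=(1-\mu)\mathbf{G}_t+\mu\mathbf{M}_t$ (Nesterov); $\mathbf{s}_t=\operatorname{sign}(\operatorname{polar}(\tilde{\mathbf{M}}_t))$; $\mathbf{X}_t=\mathbf{X}_{t-1}-\eta_t\mathbf{s}_t$. *)

theory Defs
  imports "HOL-Analysis.Analysis"
begin

text \<open>
  An \<open>m \<times> n\<close> matrix has type \<^typ>\<open>real^'n^'m\<close>. The library inner product on this type is the
  entrywise one:
\<close>

lemma inner_matrix_eq: "(A :: real^'n^'m) \<bullet> B = (\<Sum>i\<in>UNIV. \<Sum>j\<in>UNIV. A $ i $ j * B $ i $ j)"
  by (simp add: inner_vec_def)

definition orthonormal_family :: "nat \<Rightarrow> (nat \<Rightarrow> real^'n) \<Rightarrow> bool" where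
  "orthonormal_family r u \<longleftrightarrow> (\<forall>k<r. \<forall>l<r. u k \<bullet> u l = (if k = l then 1 else 0))"

text \<open>
  The inner dimension of a thin SVD is the rank, which is not known to the type system. The
  factors \<open>U\<close> and \<open>V\<close> are therefore given by their columns \<open>u k\<close> and \<open>v k\<close>, and the diagonal factor
  by its entries \<open>s k\<close>, for \<open>k < r\<close>; values at \<open>k \<ge> r\<close> are irrelevant.
\<close>

definition thin_svd ::
    "real^'n^'m \<Rightarrow> nat \<Rightarrow> (nat \<Rightarrow> real^'m) \<Rightarrow> (nat \<Rightarrow> real) \<Rightarrow> (nat \<Rightarrow> real^'n) \<Rightarrow> bool" where
  "thin_svd M r u s v \<longleftrightarrow>
     r = rank M \<and> orthonormal_family r u \<and> orthonormal_family r v \<and> (\<forall>k<r. s k > 0) \<and>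
     M = (\<chi> i j. \<Sum>k<r. u k $ i * s k * v k $ j)"

text \<open>
  The product \<open>U V\<^sup>T\<close> does not depend on the chosen thin SVD: it equals \<open>M p(M\<^sup>T M)\<close> for any
  polynomial \<open>p\<close> with \<open>p(\<sigma>\<^sup>2) = 1/\<sigma>\<close> at every nonzero singular value \<open>\<sigma>\<close> of \<open>M\<close>.
\<close>

definition polar :: "real^'n^'m \<Rightarrow> real^'n^'m" where
  "polar M = (THE P. \<exists>r u s v. thin_svd M r u s v \<and> P = (\<chi> i j. \<Sum>k<r. u k $ i * v k $ j))"

text \<open>
  \<open>is_sign A S\<close>: \<open>S\<close> is an entrywise sign of \<open>A\<close> with values in \<open>{-1, 1}\<close>, zero entries of \<open>A\<close> being
  resolved in an arbitrary way.
\<close>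

definition is_sign :: "real^'n^'m \<Rightarrow> real^'n^'m \<Rightarrow> bool" where
  "is_sign A S \<longleftrightarrow>
     (\<forall>i j. S $ i $ j \<in> {-1, 1} \<and>
            (A $ i $ j > 0 \<longrightarrow> S $ i $ j = 1) \<and> (A $ i $ j < 0 \<longrightarrow> S $ i $ j = -1))"

datatype momentum = Standard | Nesterov

text \<open>
  \<open>X\<close> is a sequence of iterates of SignMuon with exact gradients on \<open>f\<close>. Ties in the sign may be
  resolved differently in every step.
\<close>

definition signmuon ::
    "(real^'n^'m \<Rightarrow> real) \<Rightarrow> momentum \<Rightarrow> real \<Rightarrow> (nat \<Rightarrow> real) \<Rightarrow> (nat \<Rightarrow> real^'n^'m) \<Rightarrow> bool" where
  "signmuon f var \<mu> \<eta> X \<longleftrightarrow>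
     (\<exists>G M M' S.
        M 0 = 0 \<and>
        (\<forall>t\<ge>1.
           (GDERIV f (X (t - 1)) :> G t) \<and>
           M t = \<mu> *\<^sub>R M (t - 1) + (1 - \<mu>) *\<^sub>R G t \<and>
           M' t = (case var of Standard \<Rightarrow> M t | Nesterov \<Rightarrow> (1 - \<mu>) *\<^sub>R G t + \<mu> *\<^sub>R M t) \<and>
           is_sign (polar (M' t)) (S t) \<and>
           X t = X (t - 1) - \<eta> t *\<^sub>R S t))"

end

theory Submission
  imports Defs
begin

text \<open>
  Write \<open>G = Q H\<close> with \<open>Q\<close> orthogonal and \<open>H\<close> symmetric positive definite. Then \<open>polar G = Q\<close>
  whatever \<open>H\<close> is, so with \<open>S = sign Q\<close> the value \<open>\<langle>Q H, S\<rangle>\<close> is linear in \<open>H\<close>. At \<open>H = x x\<^sup>T\<close> it is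
  \<open>(Q x) \<bullet> (S x)\<close>, and nothing forces a matrix and its sign pattern to map \<open>x\<close> to vectors at an acute
  angle. If the product is negative for some \<open>x\<close>, then a large multiple of \<open>x x\<^sup>T\<close> plus a small multiple
  of the identity, which makes \<open>H\<close> definite, gives a matrix \<open>G\<close> with \<open>\<langle>G, sign (polar G)\<rangle> < 0\<close>.

  A Householder reflection \<open>Q = 1 - 2 w w\<^sup>T / (w \<bullet> w)\<close> with \<open>w\<close> close to the first axis does this with
  \<open>x = (1, 1, 1, 1)\<close>. The first row of \<open>Q\<close> has one large negative and three small positive entries: its
  sum is negative, while the signs sum to \<open>2\<close>. In the other rows two of the four signs are those of
  entries of second order, and the signs sum to \<open>0\<close>, so these rows, whose sums are positive,
  contribute nothing. For \<open>w = (-10, 1, 1, 1)\<close>, where \<open>w \<bullet> w = 103\<close>, one has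
  \<open>(Q x) \<bullet> (S x) = -74/103\<close> and \<open>\<langle>Q, S\<rangle> = 532/103\<close>; with \<open>H = 27 + 768 x x\<^sup>T\<close> this gives
  \<open>(27 \<cdot> 532 - 768 \<cdot> 74)/103 = -42468/103\<close> (lemma \<open>inner_sign_ascent_polar\<close>).

  To evaluate \<open>polar G\<close> one needs that the product \<open>U V\<^sup>T\<close> is the same for all thin singular value
  decompositions (lemma \<open>svd_partial_isometry_unique\<close>). The reason is duality of the nuclear and the
  operator norm: \<open>U V\<^sup>T\<close> maximizes \<open>\<langle>P, M\<rangle>\<close> over the partial isometries, the maximum being the sum of
  the singular values, and a maximizer is determined on the row space of \<open>M\<close>. An explicit
  decomposition of \<open>Q H\<close> comes from the eigenvectors of \<open>H\<close>, which form a Hadamard basis.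

  For the linear objective every gradient is \<open>G\<close>, so with both kinds of momentum the matrix whose polar
  factor is taken is a positive multiple of \<open>G\<close>. As \<open>polar\<close> does not see the factor, every step
  increases the objective (lemma \<open>signmuon_linear_ascends\<close>).
\<close>

section \<open>Orthonormal families\<close>

lemma orthonormal_family_norm: "orthonormal_family r u \<Longrightarrow> k < r \<Longrightarrow> norm (u k) = 1"
  by (simp add: orthonormal_family_def norm_eq_1)

lemma orthonormal_family_inner_sum:
  assumes "orthonormal_family r u" "l < r"
  shows "u l \<bullet> (\<Sum>k<r. c k *\<^sub>R u k) = c l"
proof -
  have "u l \<bullet> (\<Sum>k<r. c k *\<^sub>R u k) = (\<Sum>k<r. c k * (u l \<bullet> u k))"
    by (simp add: inner_sum_right)
  also have "\<dots> = (\<Sum>k<r. if l = k then c k else 0)"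
    using assms by (intro sum.cong) (auto simp: orthonormal_family_def)
  also have "\<dots> = c l" using assms by simp
  finally show ?thesis .
qed

lemma orthonormal_family_norm_sum:
  assumes "orthonormal_family r u"
  shows "(norm (\<Sum>k<r. c k *\<^sub>R u k))\<^sup>2 = (\<Sum>k<r. (c k)\<^sup>2)"
proof -
  have "(norm (\<Sum>k<r. c k *\<^sub>R u k))\<^sup>2 = (\<Sum>l<r. c l * (u l \<bullet> (\<Sum>k<r. c k *\<^sub>R u k)))"
    by (subst power2_norm_eq_inner, subst inner_sum_left) simp
  also have "\<dots> = (\<Sum>l<r. (c l)\<^sup>2)"
    using assms by (intro sum.cong) (auto simp: orthonormal_family_inner_sum power2_eq_square)
  finally show ?thesis .
qed

text \<open>The difference of the two sides is the squared distance of \<open>x\<close> to its projection.\<close>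

lemma bessel_inequality:
  assumes "orthonormal_family r v"
  shows "(\<Sum>k<r. (v k \<bullet> x)\<^sup>2) \<le> (norm x)\<^sup>2"
proof -
  let ?p = "\<Sum>k<r. (v k \<bullet> x) *\<^sub>R v k"
  have "x \<bullet> ?p = (\<Sum>k<r. (v k \<bullet> x)\<^sup>2)"
    by (simp add: inner_sum_right power2_eq_square inner_commute)
  moreover have "(norm (x - ?p))\<^sup>2 = (norm x)\<^sup>2 - 2 * (x \<bullet> ?p) + (norm ?p)\<^sup>2"
    by (simp add: power2_norm_eq_inner inner_diff inner_commute algebra_simps)
  ultimately have "(norm (x - ?p))\<^sup>2 = (norm x)\<^sup>2 - (\<Sum>k<r. (v k \<bullet> x)\<^sup>2)"
    using orthonormal_family_norm_sum[OF assms, of "\<lambda>k. v k \<bullet> x"] by simp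
  then show ?thesis by (smt (verit) zero_le_power2)
qed

lemma orthonormal_family_span:
  fixes v :: "nat \<Rightarrow> real^'n"
  assumes "orthonormal_family CARD('n) v"
  shows "span (v ` {..<CARD('n)}) = UNIV"
proof -
  have inj: "inj_on v {..<CARD('n)}"
    using assms by (metis (mono_tags, lifting) inj_onI lessThan_iff orthonormal_family_def zero_neq_one)
  have "0 \<notin> v ` {..<CARD('n)}"
    using orthonormal_family_norm[OF assms] by force
  moreover have "pairwise orthogonal (v ` {..<CARD('n)})"
    using assms by (auto simp: pairwise_def orthogonal_def orthonormal_family_def)
  ultimately have "independent (v ` {..<CARD('n)})"
    by (rule pairwise_orthogonal_independent[rotated])
  then show ?thesis
    using card_eq_dim[of "v ` {..<CARD('n)}" UNIV] card_image[OF inj] by auto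
qed

lemma matrix_eq_on_orthonormal_family:
  fixes A B :: "real^'n^'m"
  assumes "orthonormal_family CARD('n) v" "\<And>k. k < CARD('n) \<Longrightarrow> A *v v k = B *v v k"
  shows "A = B"
proof -
  have "A *v x = B *v x" for x
    by (rule linear_eq_on_span[of "(*v) A" "(*v) B" "v ` {..<CARD('n)}"])
      (use assms orthonormal_family_span[OF assms(1)] in \<open>auto intro: matrix_vector_mul_linear\<close>)
  then show ?thesis by (simp add: matrix_eq)
qed

section \<open>Sums of rank-one matrices\<close>

text \<open>
  With \<open>s = (\<lambda>_. 1)\<close> this is the partial isometry \<open>U V\<^sup>T\<close>, so a matrix and its polar factor can be
  treated by the same lemmas.
\<close>

definition svd_sum :: "nat \<Rightarrow> (nat \<Rightarrow> real^'m) \<Rightarrow> (nat \<Rightarrow> real) \<Rightarrow> (nat \<Rightarrow> real^'n) \<Rightarrow> real^'n^'m" where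
  "svd_sum r u s v = (\<chi> i j. \<Sum>k<r. u k $ i * s k * v k $ j)"

lemma svd_sum_mult_vec: "svd_sum r u s v *v x = (\<Sum>k<r. (s k * (v k \<bullet> x)) *\<^sub>R u k)"
proof (rule vec_eq_iff[THEN iffD2], rule allI)
  fix i
  have "(svd_sum r u s v *v x) $ i = (\<Sum>j\<in>UNIV. \<Sum>k<r. u k $ i * s k * v k $ j * x $ j)"
    by (simp add: svd_sum_def matrix_vector_mult_def sum_distrib_right)
  also have "\<dots> = (\<Sum>k<r. \<Sum>j\<in>UNIV. u k $ i * s k * v k $ j * x $ j)"
    by (rule sum.swap)
  also have "\<dots> = (\<Sum>k<r. (s k * (v k \<bullet> x)) *\<^sub>R u k) $ i"
    by (simp add: inner_vec_def sum_distrib_left sum_distrib_right mult_ac)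
  finally show "(svd_sum r u s v *v x) $ i = (\<Sum>k<r. (s k * (v k \<bullet> x)) *\<^sub>R u k) $ i" .
qed

text \<open>
  The pairing with a rank-one sum only sees how the other matrix acts on the right singular
  vectors; this turns comparisons of inner products into comparisons vector by vector.
\<close>

lemma inner_svd_sum: "A \<bullet> svd_sum r u s v = (\<Sum>k<r. s k * (u k \<bullet> (A *v v k)))"
proof -
  have "A \<bullet> svd_sum r u s v = (\<Sum>i\<in>UNIV. \<Sum>j\<in>UNIV. \<Sum>k<r. A $ i $ j * (u k $ i * s k * v k $ j))"
    by (simp add: inner_matrix_eq svd_sum_def sum_distrib_left)
  also have "\<dots> = (\<Sum>i\<in>UNIV. \<Sum>k<r. \<Sum>j\<in>UNIV. A $ i $ j * (u k $ i * s k * v k $ j))"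
    by (intro sum.cong refl sum.swap)
  also have "\<dots> = (\<Sum>k<r. \<Sum>i\<in>UNIV. \<Sum>j\<in>UNIV. A $ i $ j * (u k $ i * s k * v k $ j))"
    by (rule sum.swap)
  also have "\<dots> = (\<Sum>k<r. s k * (u k \<bullet> (A *v v k)))"
    by (simp add: inner_vec_def matrix_vector_mult_def sum_distrib_left mult_ac)
  finally show ?thesis .
qed

lemma svd_sum_mult_right_singular:
  assumes "orthonormal_family r v" "l < r"
  shows "svd_sum r u s v *v v l = s l *\<^sub>R u l"
proof -
  have "svd_sum r u s v *v v l = (\<Sum>k<r. if k = l then s k *\<^sub>R u k else 0)"
    unfolding svd_sum_mult_vec
    using assms by (intro sum.cong) (auto simp: orthonormal_family_def)
  also have "\<dots> = s l *\<^sub>R u l" using assms by simp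
  finally show ?thesis .
qed

lemma partial_isometry_norm_le:
  assumes "orthonormal_family r u" "orthonormal_family r v"
  shows "norm (svd_sum r u (\<lambda>_. 1) v *v x) \<le> norm x"
  using bessel_inequality[OF assms(2), of x] orthonormal_family_norm_sum[OF assms(1)]
  by (simp add: svd_sum_mult_vec power2_le_imp_le)

section \<open>Uniqueness of the polar factor\<close>

lemma inner_unit_le_one:
  assumes "norm a = 1" "norm b \<le> 1"
  shows "a \<bullet> b \<le> 1"
  using norm_cauchy_schwarz[of a b] assms by simp

text \<open>The equality case of the Cauchy--Schwarz inequality.\<close>

lemma inner_unit_eq_one:
  assumes "norm a = 1" "norm b \<le> 1" "a \<bullet> b = 1"
  shows "b = a"
proof -
  have "(norm (b - a))\<^sup>2 = (norm b)\<^sup>2 - 2 * (a \<bullet> b) + (norm a)\<^sup>2"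
    by (simp add: power2_norm_eq_inner inner_diff inner_commute algebra_simps)
  also have "\<dots> \<le> 0" using assms power_le_one[of "norm b" 2] by simp
  finally show ?thesis by simp
qed

text \<open>
  A partial isometry is a contraction, so each of its pairings with a pair of singular vectors is at
  most \<open>1\<close>. The bound is attained by the factor that belongs to the decomposition itself
  (\<open>svd_own_inner\<close>).
\<close>

lemma svd_partial_isometry_le:
  assumes u: "orthonormal_family r u" and v: "orthonormal_family r v" and s: "\<forall>k<r. s k > 0"
    and u': "orthonormal_family r u'" and v': "orthonormal_family r v'"
  shows "svd_sum r u' (\<lambda>_. 1) v' \<bullet> svd_sum r u s v \<le> (\<Sum>k<r. s k)"
proof -
  have "norm (svd_sum r u' (\<lambda>_. 1) v' *v v k) \<le> 1" if "k < r" for k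
    using partial_isometry_norm_le[OF u' v', of "v k"] orthonormal_family_norm[OF v that] by simp
  then show ?thesis
    unfolding inner_svd_sum using s
    by (auto intro!: sum_mono mult_left_le inner_unit_le_one orthonormal_family_norm[OF u]
        intro: less_imp_le)
qed

lemma svd_own_inner:
  assumes u: "orthonormal_family r u" and v: "orthonormal_family r v"
  shows "svd_sum r u (\<lambda>_. 1) v \<bullet> svd_sum r u s v = (\<Sum>k<r. s k)"
  using u by (auto simp: inner_svd_sum svd_sum_mult_right_singular[OF v] orthonormal_family_def
      intro!: sum.cong)

text \<open>
  Applied to both decompositions, the bound shows that each of the two partial isometries attains
  it for the other decomposition. Attaining it forces every single pairing to be \<open>1\<close>, hence the
  primed factor to map \<open>v k\<close> to \<open>u k\<close>. Orthogonally to the \<open>v k\<close> lies the kernel of the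
  matrix, where both factors vanish.
\<close>

lemma svd_partial_isometry_unique:
  assumes u: "orthonormal_family r u" and v: "orthonormal_family r v" and s: "\<forall>k<r. s k > 0"
    and u': "orthonormal_family r u'" and v': "orthonormal_family r v'" and s': "\<forall>k<r. s' k > 0"
    and eq: "svd_sum r u s v = svd_sum r u' s' v'"
  shows "svd_sum r u (\<lambda>_. 1) v = svd_sum r u' (\<lambda>_. 1) v'"
proof -
  let ?M = "svd_sum r u s v" and ?P = "svd_sum r u (\<lambda>_. 1) v" and ?P' = "svd_sum r u' (\<lambda>_. 1) v'"
  have "?P \<bullet> ?M \<le> ?P' \<bullet> ?M"
    using svd_partial_isometry_le[OF u' v' s' u v] svd_own_inner[OF u' v', of s'] eq by simp
  then have sum_le: "(\<Sum>k<r. s k) \<le> (\<Sum>k<r. s k * (u k \<bullet> (?P' *v v k)))"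
    using svd_own_inner[OF u v, of s] by (simp add: inner_svd_sum)
  have n1: "norm (?P' *v v k) \<le> 1" if "k < r" for k
    using partial_isometry_norm_le[OF u' v', of "v k"] orthonormal_family_norm[OF v that] by simp
  have le1: "u k \<bullet> (?P' *v v k) \<le> 1" if "k < r" for k
    using inner_unit_le_one[OF orthonormal_family_norm[OF u that] n1[OF that]] .
  have nonneg: "0 \<le> s k * (1 - u k \<bullet> (?P' *v v k))" if "k < r" for k
    using le1[OF that] s that by (simp add: less_imp_le)
  have "(\<Sum>k<r. s k * (1 - u k \<bullet> (?P' *v v k))) \<le> 0"
    using sum_le by (simp add: right_diff_distrib sum_subtractf)
  then have "(\<Sum>k<r. s k * (1 - u k \<bullet> (?P' *v v k))) = 0"
    using nonneg by (intro antisym sum_nonneg) auto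
  then have "\<forall>k<r. s k * (1 - u k \<bullet> (?P' *v v k)) = 0"
    using nonneg by (subst (asm) sum_nonneg_eq_0_iff) auto
  then have "u k \<bullet> (?P' *v v k) = 1" if "k < r" for k
    using s that by force
  then have agree: "?P' *v v k = u k" if "k < r" for k
    using inner_unit_eq_one[OF orthonormal_family_norm[OF u that] n1[OF that]] that by blast
  have "?P *v x = ?P' *v x" for x
  proof -
    \<comment> \<open>the component of \<open>x\<close> in the kernel\<close>
    define y where "y = x - (\<Sum>k<r. (v k \<bullet> x) *\<^sub>R v k)"
    have "v k \<bullet> y = 0" if "k < r" for k
      using orthonormal_family_inner_sum[OF v that] by (simp add: y_def inner_diff_right)
    then have "?M *v y = 0" by (simp add: svd_sum_mult_vec)
    then have "u' l \<bullet> (\<Sum>k<r. (s' k * (v' k \<bullet> y)) *\<^sub>R u' k) = 0" for l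
      unfolding eq svd_sum_mult_vec by simp
    then have "s' l * (v' l \<bullet> y) = 0" if "l < r" for l
      using orthonormal_family_inner_sum[OF u' that, of "\<lambda>k. s' k * (v' k \<bullet> y)"] by metis
    then have "v' l \<bullet> y = 0" if "l < r" for l
      using s' that by force
    then have "?P' *v y = 0" by (simp add: svd_sum_mult_vec)
    then have "?P' *v x = ?P' *v (\<Sum>k<r. (v k \<bullet> x) *\<^sub>R v k)"
      by (simp add: y_def matrix_vector_mult_diff_distrib)
    also have "\<dots> = (\<Sum>k<r. (v k \<bullet> x) *\<^sub>R (?P' *v v k))"
      by (simp add: linear_sum[OF matrix_vector_mul_linear] matrix_vector_mult_scaleR)
    also have "\<dots> = (\<Sum>k<r. (v k \<bullet> x) *\<^sub>R u k)"
      by (intro sum.cong) (auto simp: agree)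
    also have "\<dots> = ?P *v x" by (simp add: svd_sum_mult_vec)
    finally show ?thesis by simp
  qed
  then show ?thesis by (simp add: matrix_eq)
qed

lemma polar_thin_svd:
  assumes "thin_svd M r u s v"
  shows "polar M = (\<chi> i j. \<Sum>k<r. u k $ i * v k $ j)"
  unfolding polar_def
proof (rule the_equality)
  show "\<exists>r' u' s' v'. thin_svd M r' u' s' v' \<and>
      (\<chi> i j. \<Sum>k<r. u k $ i * v k $ j) = (\<chi> i j. \<Sum>k<r'. u' k $ i * v' k $ j)"
    using assms by blast
next
  fix P assume "\<exists>r' u' s' v'. thin_svd M r' u' s' v' \<and> P = (\<chi> i j. \<Sum>k<r'. u' k $ i * v' k $ j)"
  then obtain r' u' s' v' where svd: "thin_svd M r' u' s' v'"
    and P: "P = (\<chi> i j. \<Sum>k<r'. u' k $ i * v' k $ j)" by blast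
  have r: "r = rank M" and u: "orthonormal_family r u" and v: "orthonormal_family r v"
    and s: "\<forall>k<r. s k > 0" and M: "M = svd_sum r u s v"
    using assms unfolding thin_svd_def svd_sum_def by blast+
  have r': "r' = rank M" and u': "orthonormal_family r' u'" and v': "orthonormal_family r' v'"
    and s': "\<forall>k<r'. s' k > 0" and M': "M = svd_sum r' u' s' v'"
    using svd unfolding thin_svd_def svd_sum_def by blast+
  have "r' = r" using r r' by simp
  have "svd_sum r u s v = svd_sum r u' s' v'"
    using M M' \<open>r' = r\<close> by metis
  then have "svd_sum r u (\<lambda>_. 1) v = svd_sum r u' (\<lambda>_. 1) v'"
    using u v s u' v' s' unfolding \<open>r' = r\<close> by (intro svd_partial_isometry_unique)
  then show "P = (\<chi> i j. \<Sum>k<r. u k $ i * v k $ j)"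
    using P \<open>r' = r\<close> by (simp add: svd_sum_def)
qed

text \<open>
  Having an orthonormal eigenbasis with positive eigenvalues is how \<open>H\<close> is said to be symmetric
  positive definite: the eigenbasis supplies the right singular vectors and its image under \<open>Q\<close> the
  left ones.
\<close>

lemma polar_orthogonal_mult:
  fixes Q H :: "real^'n^'n"
  assumes Q: "orthogonal_matrix Q" and v: "orthonormal_family CARD('n) v"
    and H: "\<And>k. k < CARD('n) \<Longrightarrow> s k > 0 \<and> H *v v k = s k *\<^sub>R v k"
  shows "polar (Q ** H) = Q"
proof -
  let ?r = "CARD('n)"
  define u where "u k = Q *v v k" for k
  have "orthogonal_transformation ((*v) Q)"
    using Q by (simp add: orthogonal_transformation_matrix)
  then have u: "orthonormal_family ?r u"
    using v by (simp add: orthonormal_family_def u_def orthogonal_transformation_def)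
  have QH: "(Q ** H) *v v k = s k *\<^sub>R u k" if "k < ?r" for k
    using H[OF that] by (simp add: matrix_vector_mul_assoc[symmetric] matrix_vector_mult_scaleR u_def)
  have dec: "Q ** H = svd_sum ?r u s v"
    by (rule matrix_eq_on_orthonormal_family[OF v]) (simp add: QH svd_sum_mult_right_singular[OF v])
  have "u k \<in> range ((*v) (Q ** H))" if "k < ?r" for k
  proof (rule range_eqI)
    show "u k = (Q ** H) *v ((1 / s k) *\<^sub>R v k)"
      using H[OF that] by (simp add: matrix_vector_mult_scaleR QH[OF that])
  qed
  then have "span (u ` {..<?r}) \<subseteq> range ((*v) (Q ** H))"
    by (intro span_minimal linear_subspace_image[OF matrix_vector_mul_linear subspace_UNIV]) blast
  then have "surj ((*v) (Q ** H))"
    unfolding orthonormal_family_span[OF u] by blast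
  then have "rank (Q ** H) = ?r"
    by (simp only: full_rank_surjective)
  then have "thin_svd (Q ** H) ?r u s v"
    unfolding thin_svd_def
  proof (intro conjI)
    show "orthonormal_family ?r u" "orthonormal_family ?r v" by (rule u v)+
    show "\<forall>k<?r. s k > 0" using H by blast
    show "Q ** H = (\<chi> i j. \<Sum>k<?r. u k $ i * s k * v k $ j)"
      by (rule dec[unfolded svd_sum_def])
  qed (rule sym)
  then have "polar (Q ** H) = (\<chi> i j. \<Sum>k<?r. u k $ i * v k $ j)"
    by (rule polar_thin_svd)
  also have "\<dots> = svd_sum ?r u (\<lambda>_. 1) v"
    by (simp add: svd_sum_def)
  also have "\<dots> = Q"
    by (rule matrix_eq_on_orthonormal_family[OF v])
      (simp add: svd_sum_mult_right_singular[OF v] u_def)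
  finally show ?thesis .
qed

section \<open>SignMuon on a linear objective\<close>

lemma gderiv_linear_unique:
  assumes "GDERIV (\<lambda>Y. G \<bullet> Y) x :> D"
  shows "D = G"
proof -
  have "((\<lambda>Y. G \<bullet> Y) has_derivative (\<lambda>h. G \<bullet> h)) (at x)"
    by (auto intro!: derivative_eq_intros)
  then have "(\<lambda>h. h \<bullet> D) = (\<lambda>h. G \<bullet> h)"
    using assms has_derivative_unique unfolding gderiv_def by blast
  then have "\<And>h. h \<bullet> D = h \<bullet> G" by (metis inner_commute)
  then show ?thesis by (metis vector_eq_ldot)
qed

text \<open>
  The gradients being constant, momentum is a scalar recursion: the standard variant uses
  \<open>(1 - \<mu>\<^sup>t) G\<close> and the Nesterov variant \<open>(1 - \<mu>\<^sup>t\<^sup>+\<^sup>1) G\<close>. Quantifying the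
  hypothesis over all positive factors covers both variants and all steps at once.
\<close>

lemma signmuon_linear_ascends:
  fixes G :: "real^'n^'m"
  assumes bad: "\<And>c S. c > 0 \<Longrightarrow> is_sign (polar (c *\<^sub>R G)) S \<Longrightarrow> G \<bullet> S < 0"
    and \<eta>: "\<forall>t\<ge>1. \<eta> t > 0" and \<mu>: "0 \<le> \<mu>" "\<mu> < 1"
    and run: "signmuon (\<lambda>Y. G \<bullet> Y) var \<mu> \<eta> X" and t: "t \<ge> 1"
  shows "G \<bullet> X t > G \<bullet> X (t - 1)"
proof -
  from run obtain D M M' S where M0: "M 0 = 0"
    and D: "\<And>t. t \<ge> 1 \<Longrightarrow> GDERIV (\<lambda>Y. G \<bullet> Y) (X (t - 1)) :> D t"
    and M: "\<And>t. t \<ge> 1 \<Longrightarrow> M t = \<mu> *\<^sub>R M (t - 1) + (1 - \<mu>) *\<^sub>R D t"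
    and M': "\<And>t. t \<ge> 1 \<Longrightarrow>
      M' t = (case var of Standard \<Rightarrow> M t | Nesterov \<Rightarrow> (1 - \<mu>) *\<^sub>R D t + \<mu> *\<^sub>R M t)"
    and S: "\<And>t. t \<ge> 1 \<Longrightarrow> is_sign (polar (M' t)) (S t)"
    and X: "\<And>t. t \<ge> 1 \<Longrightarrow> X t = X (t - 1) - \<eta> t *\<^sub>R S t"
    unfolding signmuon_def by blast
  have D_eq: "D t = G" if "t \<ge> 1" for t
    using D[OF that] by (rule gderiv_linear_unique)
  have M_eq: "M n = (1 - \<mu> ^ n) *\<^sub>R G" for n
  proof (induction n)
    case 0
    show ?case by (simp add: M0)
  next
    case (Suc n)
    have "M (Suc n) = (\<mu> * (1 - \<mu> ^ n) + (1 - \<mu>)) *\<^sub>R G"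
      using M[of "Suc n"] D_eq[of "Suc n"] Suc.IH by (simp add: scaleR_add_left)
    then show ?case by (simp add: algebra_simps)
  qed
  have pos: "1 - \<mu> ^ n > 0" if "n \<ge> 1" for n
    using \<mu> that power_less_one_iff[of \<mu> n] by simp
  have "\<exists>c>0. M' t = c *\<^sub>R G"
  proof (cases var)
    case Standard
    then have "M' t = (1 - \<mu> ^ t) *\<^sub>R G" using M'[OF t] M_eq by simp
    then show ?thesis using pos[OF t] by blast
  next
    case Nesterov
    then have "M' t = ((1 - \<mu>) + \<mu> * (1 - \<mu> ^ t)) *\<^sub>R G"
      using M'[OF t] M_eq D_eq[OF t] by (simp add: scaleR_add_left)
    moreover have "(1 - \<mu>) + \<mu> * (1 - \<mu> ^ t) > 0"
      using \<mu> pos[OF t] by (simp add: add_pos_nonneg)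
    ultimately show ?thesis by blast
  qed
  then have "G \<bullet> S t < 0" using bad S[OF t] by auto
  then have "\<eta> t * (G \<bullet> S t) < 0" using \<eta> t by (simp add: mult_pos_neg)
  then show ?thesis using X[OF t] by (simp add: inner_diff_right)
qed

section \<open>The ascending matrix\<close>

text \<open>The Householder reflection along \<open>(-10, 1, 1, 1)\<close>.\<close>

definition ascent_polar :: "real^4^4" where
  "ascent_polar = (let w = (\<chi> i. if i = 1 then - 10 else 1) in
     \<chi> i j. (if i = j then 1 else 0) - 2 / 103 * w $ i * w $ j)"

text \<open>
  The matrix \<open>27 + 768 x x\<^sup>T\<close> with \<open>x = (1, 1, 1, 1)\<close>. The two coefficients are chosen to hit the
  prescribed value exactly.
\<close>

definition ascent_stretch :: "real^4^4" where
  "ascent_stretch = (\<chi> i j. if i = j then 795 else 768)"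

text \<open>
  The normalized columns of a Hadamard matrix. Column \<open>0\<close> is a multiple of \<open>(1, 1, 1, 1)\<close>; column
  \<open>k\<close> for \<open>1 \<le> k \<le> 3\<close> has its positive entries at the positions \<open>1\<close> and \<open>k + 1\<close>.
\<close>

definition hadamard_basis :: "nat \<Rightarrow> real^4" where
  "hadamard_basis k = (\<chi> i. if k = 0 \<or> i = 1 \<or> i = of_nat k + 1 then 1/2 else - 1/2)"

lemma less_4_cases: "(k::nat) < 4 \<longleftrightarrow> k = 0 \<or> k = 1 \<or> k = 2 \<or> k = 3"
  by auto

lemma orthonormal_hadamard_basis: "orthonormal_family 4 hadamard_basis"
  unfolding orthonormal_family_def less_4_cases
  by (auto simp: inner_vec_def sum_4 hadamard_basis_def)

lemma ascent_stretch_eigenvector: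
  assumes "k < 4"
  shows "ascent_stretch *v hadamard_basis k = (if k = 0 then 3099 else 27) *\<^sub>R hadamard_basis k"
  using assms unfolding less_4_cases
  by (auto simp: vec_eq_iff forall_4 matrix_vector_mult_def sum_4 hadamard_basis_def ascent_stretch_def)

lemma orthogonal_ascent_polar: "orthogonal_matrix ascent_polar"
  by (simp add: orthogonal_matrix vec_eq_iff forall_4 matrix_matrix_mult_def sum_4 transpose_def
      mat_def ascent_polar_def)

text \<open>The factor \<open>c\<close> is absorbed into the eigenvalues of the symmetric factor.\<close>

lemma polar_scaleR_ascent:
  assumes "c > 0"
  shows "polar (c *\<^sub>R (ascent_polar ** ascent_stretch)) = ascent_polar"
proof -
  have "c *\<^sub>R (ascent_polar ** ascent_stretch) = ascent_polar ** (c *\<^sub>R ascent_stretch)"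
    by (simp add: matrix_scalar_ac scalar_matrix_assoc)
  moreover have "polar (ascent_polar ** (c *\<^sub>R ascent_stretch)) = ascent_polar"
  proof (rule polar_orthogonal_mult)
    show "orthogonal_matrix ascent_polar" by (rule orthogonal_ascent_polar)
    show "orthonormal_family CARD(4) hadamard_basis" by (simp add: orthonormal_hadamard_basis)
  next
    fix k assume "k < CARD(4)"
    then have "k < 4" by simp
    then have "c *\<^sub>R ascent_stretch *v hadamard_basis k
        = (c * (if k = 0 then 3099 else 27)) *\<^sub>R hadamard_basis k"
      by (simp only: scaleR_matrix_vector_assoc[symmetric] ascent_stretch_eigenvector scaleR_scaleR)
    moreover have "c * (if k = 0 then 3099 else 27) > 0"
      using assms by simp
    ultimately show "c * (if k = 0 then 3099 else 27) > 0 \<and> c *\<^sub>R ascent_stretch *v hadamard_basis k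
        = (c * (if k = 0 then 3099 else 27)) *\<^sub>R hadamard_basis k"
      by blast
  qed
  ultimately show ?thesis by simp
qed

text \<open>
  No entry of the reflection vanishes, so the sign pattern is unique.
\<close>

lemma inner_sign_ascent_polar:
  assumes "is_sign ascent_polar S"
  shows "(ascent_polar ** ascent_stretch) \<bullet> S = - (42468 / 103)"
proof -
  have pos: "S $ i $ j = 1" if "i \<noteq> j \<and> (i = 1 \<or> j = 1) \<or> i = j \<and> i \<noteq> 1" for i j
  proof -
    have "ascent_polar $ i $ j > 0" using that by (auto simp: ascent_polar_def)
    then show ?thesis using assms by (simp add: is_sign_def)
  qed
  have neg: "S $ i $ j = - 1" if "i = 1 \<and> j = 1 \<or> i \<noteq> j \<and> i \<noteq> 1 \<and> j \<noteq> 1" for i j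
  proof -
    have "ascent_polar $ i $ j < 0" using that by (auto simp: ascent_polar_def)
    then show ?thesis using assms by (simp add: is_sign_def)
  qed
  show ?thesis
    by (simp add: inner_matrix_eq matrix_matrix_mult_def sum_4 pos neg ascent_polar_def ascent_stretch_def)
qed

lemma inner_eq_trace: "A \<bullet> B = trace (transpose A ** B)"
proof -
  have "A \<bullet> B = (\<Sum>j\<in>UNIV. \<Sum>i\<in>UNIV. A $ i $ j * B $ i $ j)"
    unfolding inner_matrix_eq by (rule sum.swap)
  then show ?thesis by (simp add: trace_def matrix_matrix_mult_def transpose_def)
qed

theorem theorem1:
  "\<exists>G :: real^4^4.
     (\<forall>S. is_sign (polar G) S \<longrightarrow> G \<bullet> S = - (42468 / 103) \<and> G \<bullet> S < 0) \<and>
     (\<forall>X. G \<bullet> X = trace (transpose G ** X)) \<and>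
     (\<forall>(X0 :: real^4^4) (\<eta> :: nat \<Rightarrow> real) (\<mu> :: real) (var :: momentum) (X :: nat \<Rightarrow> real^4^4).
        (\<forall>t\<ge>1. \<eta> t > 0) \<and> 0 \<le> \<mu> \<and> \<mu> < 1 \<and> X 0 = X0 \<and> signmuon (\<lambda>Y. G \<bullet> Y) var \<mu> \<eta> X \<longrightarrow>
        (\<forall>t\<ge>1. G \<bullet> X t > G \<bullet> X (t - 1)))"
proof -
  define G where "G = ascent_polar ** ascent_stretch"
  have inner: "G \<bullet> S = - (42468 / 103)" if "c > 0" "is_sign (polar (c *\<^sub>R G)) S" for c S
    using that by (simp add: G_def polar_scaleR_ascent inner_sign_ascent_polar)
  have neg: "G \<bullet> S < 0" if "c > 0" "is_sign (polar (c *\<^sub>R G)) S" for c S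
    using inner[OF that] by simp
  have "\<forall>S. is_sign (polar G) S \<longrightarrow> G \<bullet> S = - (42468 / 103) \<and> G \<bullet> S < 0"
    using inner[of 1] neg[of 1] by simp
  moreover have "\<forall>X. G \<bullet> X = trace (transpose G ** X)"
    by (simp add: inner_eq_trace)
  moreover have "G \<bullet> X t > G \<bullet> X (t - 1)"
    if "\<forall>t\<ge>1. \<eta> t > 0" "0 \<le> \<mu>" "\<mu> < 1" "signmuon (\<lambda>Y. G \<bullet> Y) var \<mu> \<eta> X" "1 \<le> t"
    for \<eta> :: "nat \<Rightarrow> real" and \<mu> var X t
    using neg that by (rule signmuon_linear_ascends)
  ultimately show ?thesis by blast
qed

end
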